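(* Let $X$ be a set and let $\alpha,\beta\in\mathcal{B}_X$. Then $\alpha\leq\beta$ in the Mitsch order on the semigroup $\mathcal{B}_X$ if and only if $$\alpha=\alpha\left(\beta^{-1}\alpha^{c}\right)^{c}=\beta\left(\beta^{-1}\alpha^{c}\right)^{c}=\left(\alpha^{c}\beta^{-1}\right)^{c}\beta .$$
   Context: $\mathcal{B}_X$ is the semigroup of all binary relations on $X$ (subsets of $X\times X$) under composition, written as juxtaposition: $(x,y)\in\alpha\beta$ iff there is $z\in X$ with $(x,z)\in\alpha$ and $(z,y)\in\beta$. For $\alpha\in\mathcal{B}_X$, $\alpha^{-1}=\{(y,x):(x,y)\in\alpha\}$ is the converse and $\alpha^{c}=(X\times X)\setminus\alpha$ the complement. The Mitsch order (natural partial order) $\leq$ on any semigroup $S$ is defined by: $a\leq b$ iff $a=b$ or there are $x,y\in S$ such that $a=ax=bx=yb$. *)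

theory Defs
  imports Main
begin

definition mitsch_le :: "'s set \<Rightarrow> ('s \<Rightarrow> 's \<Rightarrow> 's) \<Rightarrow> 's \<Rightarrow> 's \<Rightarrow> bool" where
  "mitsch_le S m a b \<longleftrightarrow>
     a = b \<or> (\<exists>x\<in>S. \<exists>y\<in>S. a = m a x \<and> a = m b x \<and> a = m y b)"

definition binrels :: "'a set \<Rightarrow> 'a rel set" where
  "binrels X = Pow (X \<times> X)"

(* The complement is relative to X, not to the ambient type. *)
definition rel_compl :: "'a set \<Rightarrow> 'a rel \<Rightarrow> 'a rel" where
  "rel_compl X \<alpha> = (X \<times> X) - \<alpha>"

(* The composition used throughout is relcomp, written O, which reads from left to
   right: (x, y) is in r O s iff (x, z) is in r and (z, y) is in s for some z.
   With the associativity O_assoc, the following makes binrels X a semigroup. *)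
lemma relcomp_in_binrels:
  "\<alpha> \<in> binrels X \<Longrightarrow> \<beta> \<in> binrels X \<Longrightarrow> \<alpha> O \<beta> \<in> binrels X"
  by (auto simp: binrels_def)

end

(* The relations (beta^-1 alpha^c)^c and (alpha^c beta^-1)^c are the residuals of alpha by beta:
   the largest x with beta x <= alpha and the largest y with y beta <= alpha. Any witnesses x, y
   of the Mitsch order therefore lie below them, and can be replaced by them. *)
theory Submission
  imports Defs
begin

lemma rel_compl_in_binrels: "rel_compl X \<alpha> \<in> binrels X"
  by (auto simp: binrels_def rel_compl_def)

text \<open>A pair of \<rho> violates the right side exactly when some x has an edge of \<beta> to
  its first point but no edge of \<alpha> to its second. The hypotheses keep such an x and the
  second point in X, where the relative complement sees them.\<close>

lemma relcomp_subset_iff_right_residual: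
  assumes "\<beta> \<in> binrels X" and "\<rho> \<in> binrels X"
  shows "\<beta> O \<rho> \<subseteq> \<alpha> \<longleftrightarrow> \<rho> \<subseteq> rel_compl X (\<beta>\<inverse> O rel_compl X \<alpha>)"
  using assms by (fastforce simp: binrels_def rel_compl_def)

lemma relcomp_subset_iff_left_residual:
  assumes "\<beta> \<in> binrels X" and "\<rho> \<in> binrels X"
  shows "\<rho> O \<beta> \<subseteq> \<alpha> \<longleftrightarrow> \<rho> \<subseteq> rel_compl X (rel_compl X \<alpha> O \<beta>\<inverse>)"
  using assms by (fastforce simp: binrels_def rel_compl_def)

theorem theorem3p1:
  fixes X :: "'a set" and \<alpha> \<beta> :: "'a rel"
  assumes "\<alpha> \<in> binrels X" and "\<beta> \<in> binrels X"
  shows "mitsch_le (binrels X) (O) \<alpha> \<beta> \<longleftrightarrow>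
    \<alpha> = \<alpha> O rel_compl X (\<beta>\<inverse> O rel_compl X \<alpha>) \<and>
    \<alpha> = \<beta> O rel_compl X (\<beta>\<inverse> O rel_compl X \<alpha>) \<and>
    \<alpha> = rel_compl X (rel_compl X \<alpha> O \<beta>\<inverse>) O \<beta>"
    (is "_ \<longleftrightarrow> \<alpha> = \<alpha> O ?R \<and> \<alpha> = \<beta> O ?R \<and> \<alpha> = ?L O \<beta>")
proof
  assume "mitsch_le (binrels X) (O) \<alpha> \<beta>"
  \<comment> \<open>If \<open>\<alpha> = \<beta>\<close>, the identity on \<open>X\<close> serves as both witnesses.\<close>
  moreover have "Id_on X \<in> binrels X" "\<alpha> = \<alpha> O Id_on X" "\<alpha> = Id_on X O \<alpha>"
    using assms(1) by (auto simp: binrels_def)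
  ultimately obtain x y where x: "x \<in> binrels X" and y: "y \<in> binrels X"
    and ax: "\<alpha> = \<alpha> O x" and bx: "\<alpha> = \<beta> O x" and yb: "\<alpha> = y O \<beta>"
    unfolding mitsch_le_def by blast
  have xR: "x \<subseteq> ?R"
    using relcomp_subset_iff_right_residual[OF assms(2) x] bx by blast
  have yL: "y \<subseteq> ?L"
    using relcomp_subset_iff_left_residual[OF assms(2) y] yb by blast
  \<comment> \<open>The equivalence is applied to \<open>?R\<close> itself, whose side condition
    \<open>?R \<subseteq> ?R\<close> is trivial.\<close>
  have bR: "\<beta> O ?R \<subseteq> \<alpha>"
    using relcomp_subset_iff_right_residual[OF assms(2) rel_compl_in_binrels] by blast
  have Lb: "?L O \<beta> \<subseteq> \<alpha>"
    using relcomp_subset_iff_left_residual[OF assms(2) rel_compl_in_binrels] by blast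
  \<comment> \<open>\<open>?R\<close> is a residual by \<beta>, so it says nothing directly about
    \<open>\<alpha> O ?R\<close>; the left witness y turns \<alpha> into \<open>y O \<beta>\<close>,
    and then \<open>bR\<close> applies.\<close>
  have "\<alpha> O ?R = y O (\<beta> O ?R)"
    by (subst yb) (rule O_assoc)
  also have "\<dots> \<subseteq> y O \<alpha>"
    using bR by (rule relcomp_mono[OF subset_refl])
  also have "y O \<alpha> = y O (\<beta> O x)"
    by (rule arg_cong[OF bx])
  also have "\<dots> = \<alpha> O x"
    using yb by (simp add: O_assoc[symmetric])
  also have "\<dots> = \<alpha>"
    by (rule ax[symmetric])
  finally have "\<alpha> O ?R \<subseteq> \<alpha>" .
  \<comment> \<open>The reverse inclusions follow by enlarging x to \<open>?R\<close> and y to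
    \<open>?L\<close>.\<close>
  moreover have "\<alpha> \<subseteq> \<alpha> O ?R"
    using relcomp_mono[OF subset_refl xR, of \<alpha>] ax by blast
  moreover have "\<alpha> \<subseteq> \<beta> O ?R"
    using relcomp_mono[OF subset_refl xR, of \<beta>] bx by blast
  moreover have "\<alpha> \<subseteq> ?L O \<beta>"
    using relcomp_mono[OF yL subset_refl, of \<beta>] yb by blast
  ultimately show "\<alpha> = \<alpha> O ?R \<and> \<alpha> = \<beta> O ?R \<and> \<alpha> = ?L O \<beta>"
    using bR Lb by blast
next
  assume "\<alpha> = \<alpha> O ?R \<and> \<alpha> = \<beta> O ?R \<and> \<alpha> = ?L O \<beta>"
  \<comment> \<open>The residuals \<open>?R\<close> and \<open>?L\<close> are themselves the
    witnesses.\<close>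
  then show "mitsch_le (binrels X) (O) \<alpha> \<beta>"
    unfolding mitsch_le_def using rel_compl_in_binrels by blast
qed

end
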